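(* Let $(X,\delta)$ be a hyperconvex and bounded diversity with induced metric space $(X,d)$, and let $T\colon (X,d)\to (X,d)$ be a nonexpansive mapping, i.e. $d(Tx,Ty)\le d(x,y)$ for all $x,y\in X$. Then $T$ has a fixed point in $X$, i.e. there is $x\in X$ with $Tx=x$.
   Context: For a set $X$, $\langle X\rangle$ denotes the set of finite subsets of $X$. A diversity is a pair $(X,\delta)$ with $\delta\colon\langle X\rangle\to\mathbb{R}$ such that (1) $\delta(A)\ge 0$ for all $A\in\langle X\rangle$, and $\delta(A)=0$ if and only if $|A|\le 1$; (2) for all $A,B,C\in\langle X\rangle$ with $B\ne\emptyset$, $\delta(A\cup C)\le\delta(A\cup B)+\delta(B\cup C)$. The induced metric on $X$ is $d(x,y)=\delta(\{x,y\})$. The diversity is bounded if there is $M\ge 0$ with $\delta(A)\le M$ for every $A\in\langle X\rangle$. A diversity $(X,\delta)$ is hyperconvex if for every $r\colon\langle X\rangle\to\mathbb{R}$ with $r(\emptyset)=0$ and $\delta\left(\bigcup_{A\in\mathcal{A}}A\right)\le\sum_{A\in\mathcal{A}}r(A)$ for all finite $\mathcal{A}\subseteq\langle X\rangle$, there is $z\in X$ such that $\delta(\{z\}\cup Y)\le r(Y)$ for all finite $Y\subseteq X$. *)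

theory Defs
  imports Complex_Main
begin

(* Fpow X is the set of finite subsets of X. A diversity is given by a carrier X
   and a total function on sets; only its values on Fpow X are ever used. *)

definition diversity :: "'a set \<Rightarrow> ('a set \<Rightarrow> real) \<Rightarrow> bool" where
  "diversity X \<delta> \<longleftrightarrow>
     (\<forall>A\<in>Fpow X. 0 \<le> \<delta> A \<and> (\<delta> A = 0 \<longleftrightarrow> card A \<le> 1)) \<and>
     (\<forall>A\<in>Fpow X. \<forall>B\<in>Fpow X. \<forall>C\<in>Fpow X. B \<noteq> {} \<longrightarrow>
        \<delta> (A \<union> C) \<le> \<delta> (A \<union> B) + \<delta> (B \<union> C))"

definition induced_metric :: "('a set \<Rightarrow> real) \<Rightarrow> 'a \<Rightarrow> 'a \<Rightarrow> real" where
  "induced_metric \<delta> x y = \<delta> {x, y}"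

definition bounded_diversity :: "'a set \<Rightarrow> ('a set \<Rightarrow> real) \<Rightarrow> bool" where
  "bounded_diversity X \<delta> \<longleftrightarrow> diversity X \<delta> \<and> (\<exists>M\<ge>0. \<forall>A\<in>Fpow X. \<delta> A \<le> M)"

(* Taking r = 0 when X is empty shows that a hyperconvex diversity has a nonempty carrier. *)

definition hyperconvex_diversity :: "'a set \<Rightarrow> ('a set \<Rightarrow> real) \<Rightarrow> bool" where
  "hyperconvex_diversity X \<delta> \<longleftrightarrow> diversity X \<delta> \<and>
     (\<forall>r :: 'a set \<Rightarrow> real.
        r {} = 0 \<and> (\<forall>\<A>. finite \<A> \<and> \<A> \<subseteq> Fpow X \<longrightarrow> \<delta> (\<Union>\<A>) \<le> (\<Sum>A\<in>\<A>. r A)) \<longrightarrow>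
        (\<exists>z\<in>X. \<forall>Y\<in>Fpow X. \<delta> ({z} \<union> Y) \<le> r Y))"

definition nonexpansive_on :: "'a set \<Rightarrow> ('a \<Rightarrow> 'a \<Rightarrow> real) \<Rightarrow> ('a \<Rightarrow> 'a) \<Rightarrow> bool" where
  "nonexpansive_on X d T \<longleftrightarrow> (\<forall>x\<in>X. \<forall>y\<in>X. d (T x) (T y) \<le> d x y)"

end

theory Submission
  imports Defs
begin

text \<open>
  Balls of the induced metric have two properties that make Kirk's fixed point argument work.
  First, a family of balls has a common point as soon as each finite subfamily does: a common
  point of finitely many balls bounds the diversity of the set of their centres by the sum of
  the radii, which is the hypothesis of hyperconvexity.  Second, a nonempty intersection \<open>D\<close> of
  balls with diameter \<open>\<Delta> > 0\<close> contains a point whose distance to all of \<open>D\<close> is at most some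
  \<open>\<rho> < \<Delta>\<close>: for \<open>k\<close> points of \<open>D\<close> the diversity is at most both \<open>(k - 1) * \<Delta>\<close> and the global
  bound \<open>M\<close>, hence at most \<open>k * \<rho>\<close> with \<open>\<rho> = \<Delta> - \<Delta> / K\<close> and \<open>K\<close> large.  By Zorn's lemma
  there is a minimal nonempty invariant intersection of balls, and it must be a single point.
\<close>

locale bounded_hyperconvex =
  fixes X :: "'a set" and \<delta> :: "'a set \<Rightarrow> real" and M :: real
  assumes hyperconvex: "hyperconvex_diversity X \<delta>"
    and bound: "A \<in> Fpow X \<Longrightarrow> \<delta> A \<le> M"
begin

abbreviation d :: "'a \<Rightarrow> 'a \<Rightarrow> real" where
  "d \<equiv> induced_metric \<delta>"

section \<open>Inequalities for a diversity and its induced metric\<close>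

lemma diversity: "diversity X \<delta>"
  using hyperconvex by (simp add: hyperconvex_diversity_def)

lemma nonneg: "A \<in> Fpow X \<Longrightarrow> 0 \<le> \<delta> A"
  using diversity by (simp add: diversity_def)

lemma zero_iff: "A \<in> Fpow X \<Longrightarrow> \<delta> A = 0 \<longleftrightarrow> card A \<le> 1"
  using diversity by (simp add: diversity_def)

lemma triangle:
  assumes "A \<in> Fpow X" "B \<in> Fpow X" "C \<in> Fpow X" "B \<noteq> {}"
  shows "\<delta> (A \<union> C) \<le> \<delta> (A \<union> B) + \<delta> (B \<union> C)"
  using diversity assms by (simp add: diversity_def)

lemma bound_nonneg: "0 \<le> M"
  using nonneg[of "{}"] bound[of "{}"] by (simp add: Fpow_def)

lemma d_commute: "d x y = d y x"
  by (simp add: induced_metric_def insert_commute)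

lemma d_self: "x \<in> X \<Longrightarrow> d x x = 0"
  using zero_iff[of "{x}"] by (simp add: induced_metric_def Fpow_def)

lemma d_nonneg: "x \<in> X \<Longrightarrow> y \<in> X \<Longrightarrow> 0 \<le> d x y"
  using nonneg[of "{x, y}"] by (simp add: induced_metric_def Fpow_def)

lemma d_le_bound: "x \<in> X \<Longrightarrow> y \<in> X \<Longrightarrow> d x y \<le> M"
  using bound[of "{x, y}"] by (simp add: induced_metric_def Fpow_def)

lemma d_eq_0:
  assumes "x \<in> X" "y \<in> X" "d x y = 0"
  shows "x = y"
  using zero_iff[of "{x, y}"] assms
  by (cases "x = y") (auto simp: induced_metric_def Fpow_def)

lemma le_insert:
  assumes "A \<in> Fpow X" "x \<in> X"
  shows "\<delta> A \<le> \<delta> (insert x A)"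
  using triangle[of A "{x}" "{}"] zero_iff[of "{x}"] assms by (simp add: Fpow_def)

text \<open>The points of \<open>A\<close> are joined one at a time through \<open>y\<close>, which
  already lies in the set, so each \<open>x\<close> costs at most \<open>d y x\<close>.\<close>

lemma union_le_sum:
  assumes "finite A" "A \<subseteq> X" "B \<in> Fpow X" "y \<in> B"
  shows "\<delta> (A \<union> B) \<le> \<delta> B + (\<Sum>x\<in>A. d y x)"
  using assms(1,2)
proof (induction A rule: finite_induct)
  case empty
  then show ?case by simp
next
  case (insert a A)
  have "\<delta> ((A \<union> B) \<union> {a}) \<le> \<delta> ((A \<union> B) \<union> {y}) + \<delta> ({y} \<union> {a})"
    by (rule triangle) (use insert assms in \<open>auto simp: Fpow_def\<close>)
  moreover have "(A \<union> B) \<union> {y} = A \<union> B" using assms by auto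
  ultimately show ?case
    using insert by (simp add: induced_metric_def insert_commute)
qed

lemma le_star:
  assumes "finite A" "A \<subseteq> X" "z \<in> X"
  shows "\<delta> A \<le> (\<Sum>x\<in>A. d z x)"
proof -
  have "\<delta> A \<le> \<delta> (insert z A)"
    using assms by (intro le_insert) (auto simp: Fpow_def)
  also have "\<dots> \<le> \<delta> {z} + (\<Sum>x\<in>A. d z x)"
    using union_le_sum[of A "{z}" z] assms by (simp add: Fpow_def)
  also have "\<delta> {z} = 0"
    using zero_iff[of "{z}"] assms by (simp add: Fpow_def)
  finally show ?thesis by simp
qed

section \<open>Intersections of balls\<close>

text \<open>\<open>G\<close> is a set of constraints (centre, radius), and a centre may carry
  several radii. Enlarging \<open>G\<close> shrinks the intersection, and \<open>balls {}\<close> is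
  \<open>X\<close>.\<close>

definition balls :: "('a \<times> real) set \<Rightarrow> 'a set" where
  "balls G = {z \<in> X. \<forall>(x, s) \<in> G. d z x \<le> s}"

lemma balls_Un: "balls (G \<union> H) = balls G \<inter> balls H"
  by (auto simp: balls_def)

text \<open>This is hyperconvexity restated for balls: \<open>sums\<close> is tested only on
  selections of one radius per centre, from which a function \<open>r\<close> on all finite sets is
  built.\<close>

lemma balls_nonempty:
  assumes G: "G \<subseteq> X \<times> UNIV"
    and sums: "\<And>A f. finite A \<Longrightarrow> (\<And>x. x \<in> A \<Longrightarrow> (x, f x) \<in> G) \<Longrightarrow> \<delta> A \<le> sum f A"
  shows "balls G \<noteq> {}"
proof -
  have G_nonneg: "0 \<le> s" if "(x, s) \<in> G" for x s
    using sums[of "{x}" "\<lambda>_. s"] nonneg[of "{x}"] that G by (auto simp: Fpow_def)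
  \<comment> \<open>Radius \<open>M\<close> excludes no point of \<open>X\<close>. It serves as
    default for points that are not centres and keeps \<open>S x\<close> nonempty, so that its
    infimum makes sense.\<close>
  define S where "S x = insert M {s. (x, s) \<in> G}" for x
  have S_nonneg: "0 \<le> s" if "s \<in> S x" for x s
    using that G_nonneg bound_nonneg by (auto simp: S_def)
  have S_bdd: "bdd_below (S x)" for x
    using S_nonneg by (rule bdd_belowI)
  have S_sums: "\<delta> A \<le> sum f A" if A: "finite A" "A \<subseteq> X" and f: "\<And>x. x \<in> A \<Longrightarrow> f x \<in> S x" for A f
  proof (cases "\<exists>x\<in>A. f x = M")
    case True
    then obtain x where "x \<in> A" "f x = M" by blast
    then have "M \<le> sum f A"
      using member_le_sum[of x A f] A f S_nonneg by auto
    moreover have "\<delta> A \<le> M"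
      using A by (intro bound) (auto simp: Fpow_def)
    ultimately show ?thesis by linarith
  next
    case False
    then show ?thesis
      using f A by (intro sums) (auto simp: S_def)
  qed
  define g where "g x = Inf (S x)" for x
  have g_nonneg: "0 \<le> g x" for x
    unfolding g_def by (rule cInf_greatest) (auto simp: S_def intro: S_nonneg[unfolded S_def])
  have g_sums: "\<delta> A \<le> sum g A" if A: "finite A" "A \<subseteq> X" for A
  \<comment> \<open>The infimum \<open>g x\<close> need not be attained, so radii within
    \<open>e'\<close> of it are selected; the \<open>+ 1\<close> in \<open>e'\<close> covers empty
    \<open>A\<close>.\<close>
  proof (rule field_le_epsilon)
    fix e :: real
    assume "0 < e"
    define e' where "e' = e / (card A + 1)"
    have "0 < e'" using \<open>0 < e\<close> by (simp add: e'_def)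
    have "\<exists>s\<in>S x. s < g x + e'" for x
      using cInf_lessD[of "S x" "g x + e'"] \<open>0 < e'\<close> by (auto simp: g_def S_def)
    then obtain f where f: "\<And>x. f x \<in> S x" "\<And>x. f x < g x + e'"
      by metis
    have "\<delta> A \<le> sum f A"
      using A f by (intro S_sums)
    also have "\<dots> \<le> (\<Sum>x\<in>A. g x + e')"
      using f(2) by (intro sum_mono less_imp_le)
    also have "\<dots> = sum g A + card A * e'"
      by (simp add: sum.distrib)
    also have "card A * e' \<le> e"
      using \<open>0 < e\<close> by (simp add: e'_def field_simps)
    finally show "\<delta> A \<le> sum g A + e" by simp
  qed
  \<comment> \<open>Only singletons carry the ball constraints. The value \<open>M\<close> on larger
    sets makes the hypothesis trivial for any family containing one.\<close>
  define r where "r Y = (if Y = {} then 0 else if is_singleton Y then g (the_elem Y) else M)" for Y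
  have r_nonneg: "0 \<le> r Y" for Y
    using g_nonneg bound_nonneg by (auto simp: r_def)
  have r_sums: "\<delta> (\<Union>\<A>) \<le> (\<Sum>Y\<in>\<A>. r Y)" if \<A>: "finite \<A>" "\<A> \<subseteq> Fpow X" for \<A>
  proof -
    have U: "\<Union>\<A> \<in> Fpow X"
      using \<A> by (auto simp: Fpow_def)
    show ?thesis
    proof (cases "\<exists>Y\<in>\<A>. Y \<noteq> {} \<and> \<not> is_singleton Y")
      case True
      then obtain Y where "Y \<in> \<A>" "r Y = M"
        unfolding r_def by metis
      then have "M \<le> sum r \<A>"
        using member_le_sum[of Y \<A> r] \<A> r_nonneg by auto
      then show ?thesis
        using bound[OF U] by linarith
    next
      case False
      then have eq: "\<A> - {{}} = (\<lambda>x. {x}) ` \<Union>\<A>"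
        by (fastforce simp: is_singleton_def)
      have "\<delta> (\<Union>\<A>) \<le> sum g (\<Union>\<A>)"
        using U by (intro g_sums) (auto simp: Fpow_def)
      also have "\<dots> = sum r ((\<lambda>x. {x}) ` \<Union>\<A>)"
        by (subst sum.reindex) (auto simp: r_def)
      also have "\<dots> = sum r (\<A> - {{}})"
        by (simp only: eq)
      also have "\<dots> = sum r \<A>"
        using \<A> by (intro sum.mono_neutral_left) (auto simp: r_def)
      finally show ?thesis .
    qed
  qed
  have "r {} = 0" by (simp add: r_def)
  then obtain z where z: "z \<in> X" "\<And>Y. Y \<in> Fpow X \<Longrightarrow> \<delta> ({z} \<union> Y) \<le> r Y"
    using hyperconvex r_sums unfolding hyperconvex_diversity_def by blast
  have "d z x \<le> s" if "(x, s) \<in> G" for x s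
  proof -
    have "d z x \<le> g x"
      using z(2)[of "{x}"] that G by (auto simp: r_def induced_metric_def Fpow_def insert_commute)
    also have "\<dots> \<le> s"
      unfolding g_def using S_bdd that by (intro cInf_lower) (auto simp: S_def)
    finally show ?thesis .
  qed
  then show ?thesis
    using z(1) by (auto simp: balls_def)
qed

text \<open>A common point of the finitely many selected balls is the hub of a star through their
  centres, which gives the sum bound.\<close>

lemma balls_compact:
  assumes G: "G \<subseteq> X \<times> UNIV"
    and fip: "\<And>F. finite F \<Longrightarrow> F \<subseteq> G \<Longrightarrow> balls F \<noteq> {}"
  shows "balls G \<noteq> {}"
proof (rule balls_nonempty[OF G])
  fix A f
  assume A: "finite A" "\<And>x. x \<in> A \<Longrightarrow> (x, f x) \<in> G"
  then obtain z where "z \<in> balls ((\<lambda>x. (x, f x)) ` A)"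
    using fip[of "(\<lambda>x. (x, f x)) ` A"] by blast
  then have z: "z \<in> X" "\<And>x. x \<in> A \<Longrightarrow> d z x \<le> f x"
    by (auto simp: balls_def)
  have "\<delta> A \<le> (\<Sum>x\<in>A. d z x)"
    using A z G by (intro le_star) auto
  also have "\<dots> \<le> sum f A"
    using z by (intro sum_mono)
  finally show "\<delta> A \<le> sum f A" .
qed

text \<open>The added balls are centred at all points of \<open>balls G\<close>, so a common point
  is within \<open>\<rho>\<close> of each of them.\<close>

lemma balls_normal_structure:
  assumes G: "G \<subseteq> X \<times> UNIV" and ne: "balls G \<noteq> {}"
    and diam: "\<And>x y. x \<in> balls G \<Longrightarrow> y \<in> balls G \<Longrightarrow> d x y \<le> \<Delta>" and "0 < \<Delta>"
  obtains \<rho> where "\<rho> < \<Delta>" "balls (G \<union> balls G \<times> {\<rho>}) \<noteq> {}"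
proof -
  \<comment> \<open>The summand 1 pays for the \<open>\<Delta>\<close> lost in
    \<open>K * \<rho> = K * \<Delta> - \<Delta>\<close>, which gives
    \<open>M \<le> K * \<rho>\<close>.\<close>
  obtain K :: nat where K: "M / \<Delta> + 1 \<le> real K"
    using real_arch_simple by blast
  have "1 \<le> real K"
    using K bound_nonneg \<open>0 < \<Delta>\<close> divide_nonneg_pos[of M \<Delta>] by linarith
  define \<rho> where "\<rho> = \<Delta> - \<Delta> / K"
  have "\<rho> < \<Delta>" "0 \<le> \<rho>"
    using \<open>1 \<le> real K\<close> \<open>0 < \<Delta>\<close> by (auto simp: \<rho>_def field_simps)
  have MK: "M \<le> K * \<rho>"
  proof -
    have "M + \<Delta> \<le> K * \<Delta>"
      using K \<open>0 < \<Delta>\<close> by (simp add: field_simps)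
    moreover have "K * \<rho> = K * \<Delta> - \<Delta>"
      using \<open>1 \<le> real K\<close> by (simp add: \<rho>_def right_diff_distrib)
    ultimately show ?thesis by linarith
  qed
  have "balls (G \<union> balls G \<times> {\<rho>}) \<noteq> {}"
  proof (rule balls_nonempty)
    show "G \<union> balls G \<times> {\<rho>} \<subseteq> X \<times> UNIV"
      using G by (auto simp: balls_def)
  next
    fix A f
    assume A: "finite A" "\<And>x. x \<in> A \<Longrightarrow> (x, f x) \<in> G \<union> balls G \<times> {\<rho>}"
    have "A \<subseteq> X"
      using A(2) G by (fastforce simp: balls_def)
    \<comment> \<open>Only the centres in \<open>B\<close> need the new radius; at the others every
      point of \<open>balls G\<close> already satisfies the constraint. A hub chosen in
      \<open>B\<close> therefore attaches \<open>A - B\<close> within the allowed radii.\<close>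
    define B where "B = {x \<in> A. x \<in> balls G \<and> f x = \<rho>}"
    have B: "finite B" "B \<subseteq> A" "B \<subseteq> balls G"
      using A(1) by (auto simp: B_def)
    have G_le: "d y x \<le> f x" if "y \<in> balls G" "x \<in> A - B" for x y
      using A(2)[of x] that by (auto simp: B_def balls_def)
    show "\<delta> A \<le> sum f A"
    proof (cases "B = {}")
      case True
      obtain z where "z \<in> balls G" using ne by blast
      then have "\<delta> A \<le> (\<Sum>x\<in>A. d z x)"
        using A \<open>A \<subseteq> X\<close> by (intro le_star) (auto simp: balls_def)
      also have "\<dots> \<le> sum f A"
        using G_le[OF \<open>z \<in> balls G\<close>] True by (intro sum_mono) auto
      finally show ?thesis .
    next
      case False
      then obtain y where "y \<in> B" by blast
      then have y: "y \<in> balls G" "y \<in> X"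
        using B by (auto simp: balls_def)
      have "B \<in> Fpow X"
        using B \<open>A \<subseteq> X\<close> by (auto simp: Fpow_def)
      have "\<delta> B \<le> card B * \<rho>"
      proof (cases "card B \<le> K")
        case True
        have "\<delta> B \<le> (\<Sum>x\<in>B. d y x)"
          using B y \<open>A \<subseteq> X\<close> by (intro le_star) auto
        \<comment> \<open>The hub is itself in \<open>B\<close>, so one term vanishes; this saved
          \<open>\<Delta>\<close> covers the loss of \<open>\<Delta> / K\<close> for each of at most
          \<open>K\<close> points.\<close>
        also have "\<dots> = (\<Sum>x\<in>B - {y}. d y x)"
          using B y by (intro sum.mono_neutral_right) (auto simp: d_self)
        also have "\<dots> \<le> (\<Sum>x\<in>B - {y}. \<Delta>)"
          using B y by (intro sum_mono diam) auto
        also have "\<dots> = (real (card B) - 1) * \<Delta>"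
          using card_Suc_Diff1[OF B(1) \<open>y \<in> B\<close>] by simp
        also have "\<dots> \<le> card B * \<rho>"
        proof -
          have "card B * (\<Delta> / K) \<le> K * (\<Delta> / K)"
            using True \<open>0 < \<Delta>\<close> by (intro mult_right_mono) auto
          also have "\<dots> = \<Delta>"
            using \<open>1 \<le> real K\<close> by simp
          finally show ?thesis
            by (simp add: \<rho>_def algebra_simps)
        qed
        finally show ?thesis .
      next
        case False
        then have "K * \<rho> \<le> card B * \<rho>"
          using \<open>0 \<le> \<rho>\<close> by (intro mult_right_mono) auto
        then show ?thesis
          using bound[OF \<open>B \<in> Fpow X\<close>] MK by linarith
      qed
      also have "card B * \<rho> = sum f B"
        by (simp add: B_def)
      finally have "\<delta> B \<le> sum f B" .
      moreover have "\<delta> ((A - B) \<union> B) \<le> \<delta> B + (\<Sum>x\<in>A - B. d y x)"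
        using A \<open>A \<subseteq> X\<close> \<open>B \<in> Fpow X\<close> \<open>y \<in> B\<close> by (intro union_le_sum) auto
      moreover have "(\<Sum>x\<in>A - B. d y x) \<le> sum f (A - B)"
        using G_le y by (intro sum_mono) auto
      moreover have "sum f A = sum f (A - B) + sum f B"
        using A B by (intro sum.subset_diff)
      moreover have "(A - B) \<union> B = A"
        using B by auto
      ultimately show ?thesis by simp
    qed
  qed
  with \<open>\<rho> < \<Delta>\<close> show ?thesis by (rule that)
qed

section \<open>Kirk's argument on a minimal invariant intersection of balls\<close>

theorem fixed_point:
  assumes T: "T ` X \<subseteq> X" and nonexp: "nonexpansive_on X d T"
  shows "\<exists>x\<in>X. T x = x"
proof -
  define \<G> where "\<G> = {G. G \<subseteq> X \<times> UNIV \<and> balls G \<noteq> {} \<and> T ` balls G \<subseteq> balls G}"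
  have "balls {} \<noteq> {}"
  proof (rule balls_nonempty)
    show "\<delta> A \<le> sum f A" if "\<And>x. x \<in> A \<Longrightarrow> (x, f x) \<in> {}" for A f
      using that zero_iff[of "{}"] by (cases "A = {}") (auto simp: Fpow_def)
  qed simp
  then have "{} \<in> \<G>"
    using T by (auto simp: \<G>_def balls_def)
  \<comment> \<open>Zorn's lemma is applied to constraint sets: a maximal \<open>G\<close> gives a
    minimal \<open>balls G\<close>, and compactness handles unions of chains.\<close>
  have "\<exists>G\<in>\<G>. \<forall>H\<in>\<G>. G \<subseteq> H \<longrightarrow> H = G"
  proof (rule subset_Zorn_nonempty)
    show "\<G> \<noteq> {}" using \<open>{} \<in> \<G>\<close> by blast
    fix \<C>
    assume \<C>: "\<C> \<noteq> {}" "subset.chain \<G> \<C>"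
    then have sub: "\<C> \<subseteq> \<G>" by (auto simp: subset.chain_def)
    then have UX: "\<Union>\<C> \<subseteq> X \<times> UNIV" by (auto simp: \<G>_def)
    have "balls (\<Union>\<C>) \<noteq> {}"
    proof (rule balls_compact[OF UX])
      fix F
      assume "finite F" "F \<subseteq> \<Union>\<C>"
      then obtain G where "G \<in> \<C>" "F \<subseteq> G"
        using finite_subset_Union_chain[OF _ _ \<C>] by metis
      then have "balls G \<subseteq> balls F" "balls G \<noteq> {}"
        using sub by (auto simp: balls_def \<G>_def)
      then show "balls F \<noteq> {}" by blast
    qed
    moreover have "balls (\<Union>\<C>) = (\<Inter>G\<in>\<C>. balls G)"
      using \<C>(1) by (fastforce simp: balls_def)
    ultimately show "\<Union>\<C> \<in> \<G>"
      using UX sub unfolding \<G>_def by fastforce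
  qed
  then obtain G where "G \<in> \<G>" and max: "\<And>H. H \<in> \<G> \<Longrightarrow> G \<subseteq> H \<Longrightarrow> H = G"
    by blast
  then have G: "G \<subseteq> X \<times> UNIV" "balls G \<noteq> {}" and inv: "\<And>z. z \<in> balls G \<Longrightarrow> T z \<in> balls G"
    by (auto simp: \<G>_def)
  have ball_X: "z \<in> X" if "z \<in> balls G" for z
    using that by (simp add: balls_def)
  \<comment> \<open>Constraints that can be added without losing nonemptiness or invariance are
    already in \<open>G\<close>, hence hold on all of \<open>balls G\<close>.\<close>
  have maxI: "H \<subseteq> G"
    if "H \<subseteq> X \<times> UNIV" "balls (G \<union> H) \<noteq> {}" "\<And>z. z \<in> balls (G \<union> H) \<Longrightarrow> T z \<in> balls H" for H
  proof -
    have "G \<union> H \<in> \<G>"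
      using that G inv unfolding \<G>_def by (auto simp: balls_Un)
    then show ?thesis using max by blast
  qed
  \<comment> \<open>By nonexpansiveness \<open>T\<close> maps \<open>balls G\<close> into the ball
    of radius \<open>\<rho>\<close> about \<open>T z\<close>, so by maximality that ball contains
    \<open>balls G\<close>.\<close>
  have radius_T: "d y (T z) \<le> \<rho>"
    if z: "z \<in> balls G" "\<And>y. y \<in> balls G \<Longrightarrow> d y z \<le> \<rho>" and y: "y \<in> balls G" for y z \<rho>
  proof -
    have "0 \<le> \<rho>"
      using z(2)[OF z(1)] d_self ball_X z(1) by simp
    have "{(T z, \<rho>)} \<subseteq> G"
    proof (rule maxI)
      show "{(T z, \<rho>)} \<subseteq> X \<times> UNIV"
        using ball_X inv z(1) by auto
      have "T z \<in> balls (G \<union> {(T z, \<rho>)})"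
        using inv[OF z(1)] \<open>0 \<le> \<rho>\<close> d_self by (auto simp: balls_def)
      then show "balls (G \<union> {(T z, \<rho>)}) \<noteq> {}" by blast
      fix w
      assume "w \<in> balls (G \<union> {(T z, \<rho>)})"
      then have w: "w \<in> balls G" by (simp only: balls_Un Int_iff)
      have "d (T w) (T z) \<le> d w z"
        using nonexp ball_X w z(1) by (simp add: nonexpansive_on_def)
      then have "d (T w) (T z) \<le> \<rho>"
        using z(2)[OF w] by linarith
      then show "T w \<in> balls {(T z, \<rho>)}"
        using ball_X[OF inv[OF w]] by (simp add: balls_def)
    qed
    then show ?thesis
      using y by (auto simp: balls_def)
  qed
  \<comment> \<open>The points within \<open>\<rho>\<close> of all of \<open>balls G\<close> form an
    invariant set by \<open>radius_T\<close>. By maximality they exhaust \<open>balls G\<close>,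
    whose diameter is then at most \<open>\<rho>\<close>.\<close>
  have radius: "d x y \<le> \<rho>"
    if "balls (G \<union> balls G \<times> {\<rho>}) \<noteq> {}" and "x \<in> balls G" "y \<in> balls G" for \<rho> x y
  proof -
    have "balls G \<times> {\<rho>} \<subseteq> G"
    proof (rule maxI)
      show "balls G \<times> {\<rho>} \<subseteq> X \<times> UNIV"
        using ball_X by auto
      fix z
      assume "z \<in> balls (G \<union> balls G \<times> {\<rho>})"
      then have z: "z \<in> balls G" "\<And>y. y \<in> balls G \<Longrightarrow> d y z \<le> \<rho>"
        by (auto simp: balls_def d_commute)
      show "T z \<in> balls (balls G \<times> {\<rho>})"
        using radius_T[OF z] ball_X[OF inv[OF z(1)]]
        by (subst balls_def) (auto simp: d_commute)
    qed (rule that(1))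
    then have "(y, \<rho>) \<in> G" using that by blast
    then show ?thesis
      using that by (auto simp: balls_def)
  qed
  define P where "P = (\<lambda>(x, y). d x y) ` (balls G \<times> balls G)"
  have "P \<noteq> {}" using G by (auto simp: P_def)
  have P_bdd: "bdd_above P"
    unfolding P_def using ball_X d_le_bound by (auto intro!: bdd_aboveI)
  have diam: "d x y \<le> Sup P" if "x \<in> balls G" "y \<in> balls G" for x y
    using that by (intro cSup_upper P_bdd) (auto simp: P_def)
  have "Sup P \<le> 0"
  proof (rule ccontr)
    assume "\<not> Sup P \<le> 0"
    then have "0 < Sup P" by simp
    then obtain \<rho> where "\<rho> < Sup P" "balls (G \<union> balls G \<times> {\<rho>}) \<noteq> {}"
      using balls_normal_structure[OF G diam] by blast
    then have "Sup P \<le> \<rho>"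
      using \<open>P \<noteq> {}\<close> radius by (intro cSup_least) (auto simp: P_def)
    with \<open>\<rho> < Sup P\<close> show False by simp
  qed
  obtain x where x: "x \<in> balls G" using G by blast
  have "d (T x) x = 0"
    using diam[OF inv[OF x] x] \<open>Sup P \<le> 0\<close> d_nonneg ball_X inv x by (metis order.antisym order.trans)
  then have "T x = x"
    using d_eq_0 ball_X inv x by blast
  then show ?thesis using ball_X x by blast
qed

end

theorem theorem4p2:
  fixes X :: "'a set" and \<delta> :: "'a set \<Rightarrow> real" and T :: "'a \<Rightarrow> 'a"
  assumes "hyperconvex_diversity X \<delta>"
    and "bounded_diversity X \<delta>"
    and "T ` X \<subseteq> X"
    and "nonexpansive_on X (induced_metric \<delta>) T"
  shows "\<exists>x\<in>X. T x = x"
proof -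
  obtain M where "\<And>A. A \<in> Fpow X \<Longrightarrow> \<delta> A \<le> M"
    using assms(2) by (auto simp: bounded_diversity_def)
  then interpret bounded_hyperconvex X \<delta> M
    using assms(1) by unfold_locales
  show ?thesis
    using assms(3,4) by (rule fixed_point)
qed

end
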